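(* For each $n$ there exists a constant $C(n)>0$, depending only on the dimension $n$, such that for every essentially bounded exponent function $p$ on $\mathbb{R}^n$, with essential upper bound $p^+$, \[ \|f-f_Q\|_{L^{p(\cdot)}\left(Q,\frac{dx}{|Q|}\right)}\le C(n)\,p^+\,\|f\|_{\mathrm{BMO}} \] for every cube $Q$ in $\mathbb{R}^n$ and every $f\in\mathrm{BMO}$.
   Context: An exponent function is a Lebesgue measurable function $p:\mathbb{R}^n\to[1,\infty]$; $p^+=\operatorname{ess\,sup}_{x\in\mathbb{R}^n}p(x)$, and essentially bounded means $p^+<\infty$. The local average is \[ \|f\|_{L^{p(\cdot)}\left(Q,\frac{dx}{|Q|}\right)}=\inf\left\{\lambda>0:\frac1{|Q|}\int_Q\left(\frac{|f(x)|}{\lambda}\right)^{p(x)}dx\le1\right\}. \] $f_Q=\frac1{|Q|}\int_Qf\,dx$, $\|f\|_{\mathrm{BMO}}=\sup_Q\frac1{|Q|}\int_Q|f-f_Q|\,dx$ over all cubes $Q\subset\mathbb{R}^n$, and $\mathrm{BMO}$ is the set of $f\in L^1_{\mathrm{loc}}(\mathbb{R}^n)$ with $\|f\|_{\mathrm{BMO}}<\infty$ (Lebesgue measure throughout). *)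

theory Defs
  imports "HOL-Analysis.Analysis" "HOL-Probability.Essential_Supremum"
begin

(* Nondegenerate cubes with sides parallel to the coordinate axes; including or excluding
   boundary faces changes none of the quantities below, since they are Lebesgue null. *)
definition cubes :: "(real ^ 'n) set set" where
  "cubes = {cbox a (a + (\<chi> i. l)) | a l. l > 0}"

definition avg :: "(real ^ 'n \<Rightarrow> real) \<Rightarrow> (real ^ 'n) set \<Rightarrow> real" where
  "avg f Q = (LINT x:Q|lebesgue. f x) / measure lebesgue Q"

(* Averages of nonnegative functions, which may be infinite. *)
definition nn_avg :: "(real ^ 'n \<Rightarrow> ennreal) \<Rightarrow> (real ^ 'n) set \<Rightarrow> ennreal" where
  "nn_avg g Q = (\<integral>\<^sup>+x\<in>Q. g x \<partial>lebesgue) / emeasure lebesgue Q"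

definition L1_loc :: "(real ^ 'n \<Rightarrow> real) set" where
  "L1_loc = {f. \<forall>K. compact K \<longrightarrow> set_integrable lebesgue K f}"

definition bmo_norm :: "(real ^ 'n \<Rightarrow> real) \<Rightarrow> ennreal" where
  "bmo_norm f = (SUP Q\<in>cubes. nn_avg (\<lambda>x. ennreal \<bar>f x - avg f Q\<bar>) Q)"

definition BMO :: "(real ^ 'n \<Rightarrow> real) set" where
  "BMO = {f \<in> L1_loc. bmo_norm f < \<infinity>}"

definition exponent_function :: "(real ^ 'n \<Rightarrow> ennreal) \<Rightarrow> bool" where
  "exponent_function p \<longleftrightarrow> p \<in> borel_measurable lebesgue \<and> (\<forall>x. 1 \<le> p x)"

definition exponent_sup :: "(real ^ 'n \<Rightarrow> ennreal) \<Rightarrow> ennreal" where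
  "exponent_sup p = esssup lebesgue p"

definition essentially_bounded :: "(real ^ 'n \<Rightarrow> ennreal) \<Rightarrow> bool" where
  "essentially_bounded p \<longleftrightarrow> exponent_sup p < \<infinity>"

(* The power t^q of a real t \<ge> 0 to an exponent q in [1,\<infinity>], where t^\<infinity> is the limit convention:
   0 for t \<le> 1 and \<infinity> for t > 1.  If the exponent function is essentially bounded, it is
   infinite only on a null set, so that the choice of this convention is immaterial. *)
definition exponent_power :: "real \<Rightarrow> ennreal \<Rightarrow> ennreal" where
  "exponent_power t q =
     (if q = \<infinity> then (if t \<le> 1 then 0 else \<infinity>) else ennreal (t powr enn2real q))"

(* The infimum is taken in [0,\<infinity>], so it is \<infinity> if no c is admissible. *)
definition local_Lp_norm ::
    "(real ^ 'n \<Rightarrow> ennreal) \<Rightarrow> (real ^ 'n) set \<Rightarrow> (real ^ 'n \<Rightarrow> real) \<Rightarrow> ennreal" where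
  "local_Lp_norm p Q f =
     (INF c\<in>{c::real. c > 0 \<and> nn_avg (\<lambda>x. exponent_power (\<bar>f x\<bar> / c) (p x)) Q \<le> 1}. ennreal c)"

end

theory Submission
  imports Defs
begin

text \<open>The estimate follows from the John--Nirenberg inequality in exponential form: if every mean
oscillation of \<open>f\<close> is at most \<open>M\<close>, then \<open>exp (b / M * \<bar>f - f_Q\<bar>)\<close> has average at most \<open>3\<close> over every
cube \<open>Q\<close>, where \<open>b > 0\<close> depends only on \<open>n\<close> (\<open>john_nirenberg_exponential\<close>). Given this, the factor
\<open>p\<^sup>+\<close> comes from an elementary inequality: \<open>t / q \<le> exp (t / q)\<close>, hence for \<open>1 \<le> r \<le> q\<close>
\<open>(t / (3 * q)) powr r \<le> exp (t * r / q) / 3 \<le> exp t / 3\<close>. With \<open>t = b / M * \<bar>f - f_Q\<bar>\<close> and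
\<open>q = p\<^sup>+\<close> this shows that \<open>3 / b * p\<^sup>+ * M\<close> is admissible in the definition of the local norm.

The John--Nirenberg inequality is first proved for averages over dyadic subcubes. Let \<open>M = 1\<close>, let
\<open>A\<close> be the average of \<open>\<bar>f - c\<bar>\<close> over \<open>Q\<close>, and let \<open>E_k c Q\<close> be the average of
\<open>exp (b * \<bar>f_R - c\<bar>)\<close> over the dyadic subcubes \<open>R\<close> of \<open>Q\<close> of generation \<open>k\<close>. Then
\<open>E_k c Q \<le> 3/2 * (1 + A)\<close> as long as \<open>A \<le> 2 ^ (n + 1)\<close>, by induction on \<open>k\<close>: the right-hand side is
affine in \<open>A\<close>, and \<open>A\<close> is the mean of the corresponding numbers of the children, so the bound passes
from the children to \<open>Q\<close>. This works while \<open>A \<le> 2\<close>, because passing to a child increases \<open>A\<close> at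
most by the factor \<open>2 ^ n\<close>. Once \<open>A > 2\<close>, the constant \<open>c\<close> is replaced by \<open>f_Q\<close>, which costs a
factor \<open>exp (b * A) \<le> 3/2\<close> but brings \<open>A\<close> down to at most \<open>1\<close>; the gain in \<open>A\<close> pays for the
factor. The subcubes where this restart happens are the maximal cubes of a Calderon--Zygmund
decomposition.

The passage from dyadic averages to \<open>f\<close> itself rests on convergence in \<open>L\<^sup>1\<close>: for a Lipschitz
function \<open>\<Psi>\<close>, replacing \<open>f\<close> by its averages changes the integral of \<open>\<Psi> \<circ> f\<close> by no more
than a multiple of the total oscillation of \<open>f\<close> over the small cubes, and that tends to \<open>0\<close>
because continuous functions are dense in \<open>L\<^sup>1\<close>. Truncated exponentials are Lipschitz, and
monotone convergence removes the truncation.\<close>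

section \<open>Half-open cubes and their children\<close>

text \<open>Half-open cubes split exactly, not just up to null sets, into \<open>2 ^ n\<close> cubes of half the side
length; the children are indexed by the set of coordinates in which the upper half is taken.\<close>

definition half_open_cube :: "real ^ 'n \<Rightarrow> real \<Rightarrow> (real ^ 'n) set" where
  "half_open_cube a l = {x. \<forall>i. a $ i \<le> x $ i \<and> x $ i < a $ i + l}"

definition child_corner :: "real ^ 'n \<Rightarrow> real \<Rightarrow> 'n set \<Rightarrow> real ^ 'n" where
  "child_corner a l S = a + (\<chi> i. if i \<in> S then l / 2 else 0)"

lemma box_subset_half_open_cube_subset_cbox:
  "box a (a + (\<chi> i. l)) \<subseteq> half_open_cube a l" "half_open_cube a l \<subseteq> cbox a (a + (\<chi> i. l))"
  unfolding half_open_cube_def by (auto simp: mem_box_cart) (meson less_imp_le)+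

lemma half_open_cube_borel [measurable]: "half_open_cube a l \<in> sets borel"
proof -
  have "half_open_cube a l = (\<Inter>i. {x. a $ i \<le> x $ i} \<inter> {x. x $ i < a $ i + l})"
    by (auto simp: half_open_cube_def)
  also have "\<dots> \<in> sets borel"
    by (intro sets.countable_INT'' sets.Int borel_closed borel_open closed_halfspace_component_ge_cart
        open_halfspace_component_lt_cart) auto
  finally show ?thesis .
qed

lemma half_open_cube_lebesgue [measurable]: "half_open_cube a l \<in> sets lebesgue"
  using half_open_cube_borel by (simp add: sets_completionI_sets)

lemma AE_half_open_cube_iff_cbox:
  "AE x in lebesgue. x \<in> half_open_cube a l \<longleftrightarrow> x \<in> cbox a (a + (\<chi> i. l))"
proof -
  have "cbox a (a + (\<chi> i. l)) - box a (a + (\<chi> i. l)) \<in> null_sets lebesgue"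
    by (metis negligible_frontier_interval negligible_iff_null_sets)
  then show ?thesis
    by (rule AE_I') (use box_subset_half_open_cube_subset_cbox[of a l] in auto)
qed

lemma emeasure_half_open_cube:
  fixes a :: "real ^ 'n"
  assumes "l > 0"
  shows "emeasure lebesgue (half_open_cube a l) = ennreal (l ^ CARD('n))"
    and "emeasure lborel (half_open_cube a l) = ennreal (l ^ CARD('n))"
proof -
  have "emeasure lebesgue (half_open_cube a l) = emeasure lebesgue (cbox a (a + (\<chi> i. l)))"
    by (intro emeasure_eq_AE AE_half_open_cube_iff_cbox) auto
  also have "\<dots> = ennreal (l ^ CARD('n))"
  proof -
    have "cbox a (a + (\<chi> i. l)) \<noteq> {}"
      using assms by (auto simp: interval_ne_empty_cart)
    then have "measure lborel (cbox a (a + (\<chi> i. l))) = l ^ CARD('n)"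
      by (simp add: content_cbox_cart)
    then show ?thesis
      using emeasure_lborel_cbox_finite[of a "a + (\<chi> i. l)"]
      by (simp add: emeasure_eq_ennreal_measure less_top)
  qed
  finally show "emeasure lebesgue (half_open_cube a l) = ennreal (l ^ CARD('n))" .
  then show "emeasure lborel (half_open_cube a l) = ennreal (l ^ CARD('n))"
    by simp
qed

lemma measure_half_open_cube:
  fixes a :: "real ^ 'n"
  assumes "l > 0"
  shows "measure lebesgue (half_open_cube a l) = l ^ CARD('n)"
    and "measure lborel (half_open_cube a l) = l ^ CARD('n)"
  unfolding measure_def using emeasure_half_open_cube[OF assms, of a] assms by simp_all

lemma mem_child_iff:
  fixes a :: "real ^ 'n"
  assumes "l > 0"
  shows "x \<in> half_open_cube (child_corner a l S) (l / 2) \<longleftrightarrow>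
    x \<in> half_open_cube a l \<and> S = {i. a $ i + l / 2 \<le> x $ i}"
proof -
  have "(a $ i + (if i \<in> S then l / 2 else 0) \<le> x $ i \<and>
       x $ i < a $ i + (if i \<in> S then l / 2 else 0) + l / 2) \<longleftrightarrow>
      (a $ i \<le> x $ i \<and> x $ i < a $ i + l) \<and> (i \<in> S \<longleftrightarrow> a $ i + l / 2 \<le> x $ i)" for i
    using assms by (cases "i \<in> S") auto
  then have "(\<forall>i. a $ i + (if i \<in> S then l / 2 else 0) \<le> x $ i \<and>
       x $ i < a $ i + (if i \<in> S then l / 2 else 0) + l / 2) \<longleftrightarrow>
      (\<forall>i. a $ i \<le> x $ i \<and> x $ i < a $ i + l) \<and> (\<forall>i. i \<in> S \<longleftrightarrow> a $ i + l / 2 \<le> x $ i)"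
    by blast
  then show ?thesis
    by (simp add: half_open_cube_def child_corner_def set_eq_iff)
qed

lemma child_subset:
  "l > 0 \<Longrightarrow> half_open_cube (child_corner a l S) (l / 2) \<subseteq> half_open_cube a l"
  by (simp add: mem_child_iff subset_iff)

lemma indicator_half_open_cube_children:
  fixes a :: "real ^ 'n"
  assumes "l > 0"
  shows "indicator (half_open_cube a l) x
       = (\<Sum>S\<in>UNIV. indicator (half_open_cube (child_corner a l S) (l / 2)) x :: real)"
proof -
  have "(\<Sum>S\<in>UNIV. indicator (half_open_cube (child_corner a l S) (l / 2)) x :: real)
     = (\<Sum>S\<in>UNIV. if S = {i. a $ i + l / 2 \<le> x $ i} then indicator (half_open_cube a l) x else 0)"
    by (intro sum.cong) (auto simp: indicator_def mem_child_iff[OF assms])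
  then show ?thesis by simp
qed

section \<open>Means and sums over dyadic subcubes\<close>

abbreviation cube_integral :: "(real ^ 'n \<Rightarrow> real) \<Rightarrow> real ^ 'n \<Rightarrow> real \<Rightarrow> real" where
  "cube_integral f a l \<equiv> LINT x:half_open_cube a l|lebesgue. f x"

definition cube_mean :: "(real ^ 'n \<Rightarrow> real) \<Rightarrow> real ^ 'n \<Rightarrow> real \<Rightarrow> real" where
  "cube_mean f a l = cube_integral f a l / l ^ CARD('n)"

lemma cube_integral_children:
  fixes f :: "real ^ 'n \<Rightarrow> real"
  assumes "set_integrable lebesgue (half_open_cube a l) f" "l > 0"
  shows "cube_integral f a l = (\<Sum>S\<in>UNIV. cube_integral f (child_corner a l S) (l / 2))"
proof -
  have int: "integrable lebesgue (\<lambda>x. indicator (half_open_cube (child_corner a l S) (l / 2)) x * f x)" for S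
    using set_integrable_subset[OF assms(1) half_open_cube_lebesgue child_subset[OF assms(2)]]
    by (simp add: set_integrable_def)
  show ?thesis
    unfolding set_lebesgue_integral_def real_scaleR_def indicator_half_open_cube_children[OF assms(2)]
      sum_distrib_right
    by (rule Bochner_Integration.integral_sum[OF int])
qed

lemma set_integrable_const_cube [simp]:
  "l > 0 \<Longrightarrow> set_integrable lebesgue (half_open_cube a l) (\<lambda>x. c :: real)"
  unfolding set_integrable_def real_scaleR_def
  by (intro integrable_mult_left integrable_real_indicator) (auto simp: emeasure_half_open_cube)

lemma cube_integral_const:
  fixes a :: "real ^ 'n"
  shows "l > 0 \<Longrightarrow> cube_integral (\<lambda>x. c) a l = c * l ^ CARD('n)"
  by (subst set_integral_const) (auto simp: emeasure_half_open_cube measure_half_open_cube)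

text \<open>The sum of \<open>F\<close> over the \<open>k\<close>-th generation of dyadic subcubes. Recursion through the children avoids
an explicit enumeration of that generation.\<close>

fun dyadic_sum :: "nat \<Rightarrow> (real ^ 'n \<Rightarrow> real \<Rightarrow> real) \<Rightarrow> real ^ 'n \<Rightarrow> real \<Rightarrow> real" where
  "dyadic_sum 0 F a l = F a l"
| "dyadic_sum (Suc k) F a l = (\<Sum>S\<in>UNIV. dyadic_sum k F (child_corner a l S) (l / 2))"

text \<open>The comparison may use that the subcubes have side \<open>l / 2 ^ k\<close> and lie in the large cube; uniform
continuity will be applied on that scale.\<close>

lemma dyadic_sum_mono:
  assumes "\<And>a' l'. l' > 0 \<Longrightarrow> l' = l / 2 ^ k \<Longrightarrow> half_open_cube a' l' \<subseteq> half_open_cube a l \<Longrightarrow> F a' l' \<le> G a' l'"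
    and "l > 0"
  shows "dyadic_sum k F a l \<le> dyadic_sum k G a l"
  using assms
proof (induction k arbitrary: a l)
  case (Suc k)
  show ?case
    unfolding dyadic_sum.simps
  proof (intro sum_mono Suc.IH)
    fix S a' l' assume *: "l' > (0::real)" "l' = l / 2 / 2 ^ k"
      "half_open_cube a' l' \<subseteq> half_open_cube (child_corner a l S) (l / 2)"
    then show "F a' l' \<le> G a' l'"
      using child_subset[OF \<open>l > 0\<close>, of a S] by (intro Suc.prems) auto
  qed (use Suc.prems in auto)
qed auto

lemma dyadic_sum_add:
  "dyadic_sum k (\<lambda>a l. F a l + G a l) a l = dyadic_sum k F a l + dyadic_sum k G a l"
  by (induction k arbitrary: a l) (auto simp: sum.distrib)

lemma dyadic_sum_cmult: "dyadic_sum k (\<lambda>a l. c * F a l) a l = c * dyadic_sum k F a l"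
  by (induction k arbitrary: a l) (auto simp: sum_distrib_left)

lemma dyadic_sum_integral:
  assumes "set_integrable lebesgue (half_open_cube a l) f" "l > 0"
  shows "dyadic_sum k (cube_integral f) a l = cube_integral f a l"
  using assms
proof (induction k arbitrary: a l)
  case (Suc k)
  have "set_integrable lebesgue (half_open_cube (child_corner a l S) (l / 2)) f" for S
    using set_integrable_subset[OF Suc.prems(1) half_open_cube_lebesgue child_subset] Suc.prems by auto
  then show ?case
    using Suc.IH Suc.prems cube_integral_children[OF Suc.prems] by simp
qed auto


lemma set_integrable_abs_diff_const:
  fixes f :: "real ^ 'n \<Rightarrow> real"
  assumes "set_integrable lebesgue (half_open_cube a l) f" "l > 0"
  shows "set_integrable lebesgue (half_open_cube a l) (\<lambda>x. \<bar>f x - c\<bar>)"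
  by (intro set_integrable_abs set_integral_diff(1) assms set_integrable_const_cube)

lemma cube_mean_diff_le:
  fixes f :: "real ^ 'n \<Rightarrow> real"
  assumes f: "set_integrable lebesgue (half_open_cube a l) f" and l: "l > 0"
  shows "\<bar>cube_mean f a l - c\<bar> * l ^ CARD('n) \<le> cube_integral (\<lambda>x. \<bar>f x - c\<bar>) a l"
proof -
  have "(cube_mean f a l - c) * l ^ CARD('n) = cube_integral (\<lambda>x. f x - c) a l"
    using l by (simp add: cube_mean_def set_integral_diff(2)[OF f] cube_integral_const field_simps)
  then have "\<bar>cube_mean f a l - c\<bar> * l ^ CARD('n) = \<bar>cube_integral (\<lambda>x. f x - c) a l\<bar>"
    using l by (metis abs_mult abs_of_nonneg less_imp_le zero_less_power)
  also have "\<dots> \<le> cube_integral (\<lambda>x. \<bar>f x - c\<bar>) a l"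
    using integral_abs_bound[of lebesgue "\<lambda>x. indicator (half_open_cube a l) x * (f x - c)"]
    by (simp add: set_lebesgue_integral_def abs_mult)
  finally show ?thesis .
qed

lemma cube_integral_nonneg: "(\<And>x. f x \<ge> 0) \<Longrightarrow> cube_integral f a l \<ge> 0"
  unfolding set_lebesgue_integral_def by (intro integral_nonneg_AE) auto

text \<open>Not divided by the volume, so that oscillations over disjoint cubes can be added directly.\<close>

definition oscillation :: "(real ^ 'n \<Rightarrow> real) \<Rightarrow> real ^ 'n \<Rightarrow> real \<Rightarrow> real" where
  "oscillation f a l = cube_integral (\<lambda>x. \<bar>f x - cube_mean f a l\<bar>) a l"

text \<open>The mean is a best constant up to the factor \<open>2\<close>: it differs from \<open>c\<close> by at most the average of
\<open>\<bar>f - c\<bar>\<close>.\<close>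

lemma oscillation_le:
  fixes f :: "real ^ 'n \<Rightarrow> real"
  assumes f: "set_integrable lebesgue (half_open_cube a l) f" and l: "l > 0"
  shows "oscillation f a l \<le> 2 * cube_integral (\<lambda>x. \<bar>f x - c\<bar>) a l"
proof -
  have "oscillation f a l \<le> cube_integral (\<lambda>x. \<bar>f x - c\<bar> + \<bar>cube_mean f a l - c\<bar>) a l"
    unfolding oscillation_def
    by (intro set_integral_mono set_integral_add(1) set_integrable_abs_diff_const[OF f l] set_integrable_const_cube[OF l]) auto
  also have "\<dots> = cube_integral (\<lambda>x. \<bar>f x - c\<bar>) a l + \<bar>cube_mean f a l - c\<bar> * l ^ CARD('n)"
    by (simp add: set_integral_add(2)[OF set_integrable_abs_diff_const[OF f l] set_integrable_const_cube[OF l]]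
        cube_integral_const[OF l])
  finally show ?thesis
    using cube_mean_diff_le[OF f l, of c] by simp
qed

section \<open>Exponential bound for dyadic averages\<close>

text \<open>The core of the John--Nirenberg inequality. The bound is affine in \<open>J = \<integral>\<bar>f - c\<bar>\<close>, which is
additive over children, so it is inherited from them; this needs the hypothesis
\<open>J \<le> 2 ^ (n + 1) * l ^ n\<close> for the children, which follows when \<open>J \<le> 2 * l ^ n\<close> for the parent. For
larger \<open>J\<close> the constant \<open>c\<close> is replaced by the mean: with \<open>V = l ^ n\<close> the new bound
\<open>3/2 * (3/2 * (V + V))\<close> equals \<open>3/2 * (V + 2 * V)\<close>, which is at most \<open>3/2 * (V + J)\<close>.\<close>

lemma dyadic_sum_exp_le:
  fixes f :: "real ^ 'n \<Rightarrow> real"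
  assumes int: "\<And>a l. l > 0 \<Longrightarrow> set_integrable lebesgue (half_open_cube a l) f"
    and osc: "\<And>a l. l > 0 \<Longrightarrow> oscillation f a l \<le> l ^ CARD('n)"
    and b: "0 \<le> b" "exp (b * 2 ^ (CARD('n) + 1)) \<le> 3 / 2"
    and l: "l > 0"
    and J: "cube_integral (\<lambda>x. \<bar>f x - c\<bar>) a l \<le> 2 ^ (CARD('n) + 1) * l ^ CARD('n)"
  shows "dyadic_sum k (\<lambda>a l. l ^ CARD('n) * exp (b * \<bar>cube_mean f a l - c\<bar>)) a l
       \<le> 3 / 2 * (l ^ CARD('n) + cube_integral (\<lambda>x. \<bar>f x - c\<bar>) a l)"
  using l J
proof (induction k arbitrary: a l c)
  have exp_mean: "exp (b * \<bar>cube_mean f a l - c\<bar>) \<le> 3 / 2"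
    if l: "l > 0" and "cube_integral (\<lambda>x. \<bar>f x - c\<bar>) a l \<le> 2 ^ (CARD('n) + 1) * l ^ CARD('n)" for a l c
  proof -
    have "\<bar>cube_mean f a l - c\<bar> * l ^ CARD('n) \<le> 2 ^ (CARD('n) + 1) * l ^ CARD('n)"
      using cube_mean_diff_le[OF int[OF l] l, of a c] that by linarith
    then have "\<bar>cube_mean f a l - c\<bar> \<le> 2 ^ (CARD('n) + 1)"
      using l by (subst (asm) mult_le_cancel_right) auto
    then have "exp (b * \<bar>cube_mean f a l - c\<bar>) \<le> exp (b * 2 ^ (CARD('n) + 1))"
      using b by (simp add: mult_left_mono)
    then show ?thesis using b(2) by (rule order_trans)
  qed
  {
    case 0
    have "l ^ CARD('n) * exp (b * \<bar>cube_mean f a l - c\<bar>) \<le> l ^ CARD('n) * (3 / 2)"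
      using 0 by (intro mult_left_mono exp_mean) auto
    also have "\<dots> \<le> 3 / 2 * (l ^ CARD('n) + cube_integral (\<lambda>x. \<bar>f x - c\<bar>) a l)"
      using cube_integral_nonneg[of "\<lambda>x. \<bar>f x - c\<bar>" a l] by simp
    finally show ?case by simp
  next
    case (Suc k)
    note l = \<open>l > 0\<close>
    \<comment> \<open>The inheritance from the children, stated for every \<open>c\<close> since it is used again with the mean.\<close>
    have small: "dyadic_sum (Suc k) (\<lambda>a l. l ^ CARD('n) * exp (b * \<bar>cube_mean f a l - c\<bar>)) a l
       \<le> 3 / 2 * (l ^ CARD('n) + cube_integral (\<lambda>x. \<bar>f x - c\<bar>) a l)"
      if c: "cube_integral (\<lambda>x. \<bar>f x - c\<bar>) a l \<le> 2 * l ^ CARD('n)" for c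
    proof -
      define J where "J = (\<lambda>S. cube_integral (\<lambda>x. \<bar>f x - c\<bar>) (child_corner a l S) (l / 2))"
      have sumJ: "cube_integral (\<lambda>x. \<bar>f x - c\<bar>) a l = (\<Sum>S\<in>UNIV. J S)"
        unfolding J_def by (rule cube_integral_children[OF set_integrable_abs_diff_const[OF int] l]) (rule l)+
      have J0: "J S \<ge> 0" for S
        unfolding J_def by (intro cube_integral_nonneg) auto
      have "J S \<le> (\<Sum>S\<in>UNIV. J S)" for S
        using J0 by (intro member_le_sum) auto
      then have JS: "J S \<le> 2 ^ (CARD('n) + 1) * (l / 2) ^ CARD('n)" for S
        using c unfolding sumJ by (simp add: power_divide) (meson order_trans)
      have vol: "l ^ CARD('n) = (\<Sum>S\<in>(UNIV :: 'n set set). (l / 2) ^ CARD('n))"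
        using cube_integral_children[OF set_integrable_const_cube[OF l, of a 1] l] l
        by (simp add: cube_integral_const)
      have "dyadic_sum (Suc k) (\<lambda>a l. l ^ CARD('n) * exp (b * \<bar>cube_mean f a l - c\<bar>)) a l
          \<le> (\<Sum>S\<in>UNIV. 3 / 2 * ((l / 2) ^ CARD('n) + J S))"
        unfolding dyadic_sum.simps J_def using l JS[unfolded J_def] by (intro sum_mono Suc.IH) auto
      also have "\<dots> = 3 / 2 * (l ^ CARD('n) + cube_integral (\<lambda>x. \<bar>f x - c\<bar>) a l)"
        unfolding sumJ vol by (simp only: sum.distrib sum_distrib_left[symmetric])
      finally show ?thesis .
    qed
    show ?case
    proof (cases "cube_integral (\<lambda>x. \<bar>f x - c\<bar>) a l \<le> 2 * l ^ CARD('n)")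
      case True
      then show ?thesis by (rule small)
    next
      case False
      define m where "m = cube_mean f a l"
      have osc': "cube_integral (\<lambda>x. \<bar>f x - m\<bar>) a l \<le> l ^ CARD('n)"
        using osc[OF l, of a] by (simp add: oscillation_def m_def)
      have m: "exp (b * \<bar>m - c\<bar>) \<le> 3 / 2"
        unfolding m_def by (rule exp_mean) fact+
      have "dyadic_sum (Suc k) (\<lambda>a l. l ^ CARD('n) * exp (b * \<bar>cube_mean f a l - c\<bar>)) a l
         \<le> dyadic_sum (Suc k) (\<lambda>a l. 3 / 2 * (l ^ CARD('n) * exp (b * \<bar>cube_mean f a l - m\<bar>))) a l"
      proof (rule dyadic_sum_mono[OF _ l])
        fix a' and l' :: real assume "l' > 0"
        have "exp (b * \<bar>cube_mean f a' l' - c\<bar>) \<le> exp (b * \<bar>m - c\<bar> + b * \<bar>cube_mean f a' l' - m\<bar>)"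
          unfolding exp_le_cancel_iff distrib_left[symmetric] using b by (intro mult_left_mono) auto
        also have "\<dots> \<le> 3 / 2 * exp (b * \<bar>cube_mean f a' l' - m\<bar>)"
          unfolding exp_add using m by (intro mult_right_mono) auto
        finally show "l' ^ CARD('n) * exp (b * \<bar>cube_mean f a' l' - c\<bar>) \<le>
            3 / 2 * (l' ^ CARD('n) * exp (b * \<bar>cube_mean f a' l' - m\<bar>))"
          using \<open>l' > 0\<close> by (simp add: mult.left_commute mult_left_mono)
      qed
      also have "\<dots> = 3 / 2 * dyadic_sum (Suc k) (\<lambda>a l. l ^ CARD('n) * exp (b * \<bar>cube_mean f a l - m\<bar>)) a l"
        by (rule dyadic_sum_cmult)
      also have "\<dots> \<le> 3 / 2 * (3 / 2 * (l ^ CARD('n) + cube_integral (\<lambda>x. \<bar>f x - m\<bar>) a l))"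
        using osc' zero_less_power[OF l, of "CARD('n)"] by (intro mult_left_mono small) linarith+
      also have "\<dots> \<le> 3 / 2 * (l ^ CARD('n) + cube_integral (\<lambda>x. \<bar>f x - c\<bar>) a l)"
        using osc' False by simp
      finally show ?thesis .
    qed
  }
qed

section \<open>From dyadic averages to the function\<close>

lemma set_integrable_lipschitz:
  fixes f :: "real ^ 'n \<Rightarrow> real" and \<Psi> :: "real \<Rightarrow> real"
  assumes f: "set_integrable lebesgue (half_open_cube a l) f" and l: "l > 0"
    and lip: "\<And>s t. \<bar>\<Psi> s - \<Psi> t\<bar> \<le> K * \<bar>s - t\<bar>"
  shows "set_integrable lebesgue (half_open_cube a l) (\<lambda>x. \<Psi> (f x))"
proof -
  have "K \<ge> 0"
    using lip[of 1 0] by simp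
  then have "K-lipschitz_on UNIV \<Psi>"
    using lip by (auto simp: lipschitz_on_def dist_real_def)
  then have "continuous_on UNIV \<Psi>"
    by (rule lipschitz_on_continuous_on)
  then have [measurable]: "\<Psi> \<in> borel_measurable borel"
    by (rule borel_measurable_continuous_onI)
  define F where "F = (\<lambda>x. indicator (half_open_cube a l) x * f x)"
  have [measurable]: "F \<in> borel_measurable lebesgue"
    using f unfolding F_def set_integrable_def real_scaleR_def by (rule borel_measurable_integrable)
  have "integrable lebesgue (\<lambda>x. indicator (half_open_cube a l) x * \<Psi> (F x))"
  proof (rule Bochner_Integration.integrable_bound)
    show "integrable lebesgue (\<lambda>x. indicator (half_open_cube a l) x * \<bar>\<Psi> 0\<bar> + K * \<bar>F x\<bar>)"
      using f set_integrable_const_cube[OF l, of a "\<bar>\<Psi> 0\<bar>"]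
      unfolding F_def set_integrable_def real_scaleR_def
      by (intro Bochner_Integration.integrable_add integrable_mult_right integrable_abs) auto
    have "\<bar>\<Psi> t\<bar> \<le> \<bar>\<Psi> 0\<bar> + K * \<bar>t\<bar>" for t
      using lip[of t 0] by simp
    then show "AE x in lebesgue. norm (indicator (half_open_cube a l) x * \<Psi> (F x)) \<le>
       norm (indicator (half_open_cube a l) x * \<bar>\<Psi> 0\<bar> + K * \<bar>F x\<bar>)"
      using \<open>K \<ge> 0\<close> by (auto simp: indicator_def)
  qed measurable
  also have "(\<lambda>x. indicator (half_open_cube a l) x * \<Psi> (F x)) = (\<lambda>x. indicator (half_open_cube a l) x * \<Psi> (f x))"
    by (auto simp: F_def indicator_def)
  finally show ?thesis
    by (simp add: set_integrable_def)
qed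

text \<open>On each small cube \<open>R\<close>, \<open>\<Psi> (f x)\<close> exceeds \<open>\<Psi> (f_R)\<close> by at most \<open>K * \<bar>f x - f_R\<bar>\<close>; integrate and
add up.\<close>

lemma cube_integral_lipschitz_le:
  fixes f :: "real ^ 'n \<Rightarrow> real" and \<Psi> :: "real \<Rightarrow> real"
  assumes f: "set_integrable lebesgue (half_open_cube a l) f" and l: "l > 0"
    and lip: "\<And>s t. \<bar>\<Psi> s - \<Psi> t\<bar> \<le> K * \<bar>s - t\<bar>"
  shows "cube_integral (\<lambda>x. \<Psi> (f x)) a l \<le>
     dyadic_sum k (\<lambda>a l. l ^ CARD('n) * \<Psi> (cube_mean f a l)) a l + K * dyadic_sum k (oscillation f) a l"
proof -
  have "cube_integral (\<lambda>x. \<Psi> (f x)) a l = dyadic_sum k (cube_integral (\<lambda>x. \<Psi> (f x))) a l"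
    by (rule dyadic_sum_integral[symmetric, OF set_integrable_lipschitz[OF f l lip] l])
  also have "\<dots> \<le> dyadic_sum k (\<lambda>a l. l ^ CARD('n) * \<Psi> (cube_mean f a l) + K * oscillation f a l) a l"
  proof (rule dyadic_sum_mono[OF _ l])
    fix a' and l' :: real assume l': "l' > 0" and "half_open_cube a' l' \<subseteq> half_open_cube a l"
    then have f': "set_integrable lebesgue (half_open_cube a' l') f"
      by (intro set_integrable_subset[OF f]) auto
    have "cube_integral (\<lambda>x. \<Psi> (f x)) a' l'
       \<le> cube_integral (\<lambda>x. \<Psi> (cube_mean f a' l') + K * \<bar>f x - cube_mean f a' l'\<bar>) a' l'"
    proof (intro set_integral_mono set_integral_add(1) set_integrable_mult_right
        set_integrable_const_cube[OF l'] set_integrable_abs_diff_const[OF f' l'] set_integrable_lipschitz[OF f' l' lip])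
      show "\<Psi> (f x) \<le> \<Psi> (cube_mean f a' l') + K * \<bar>f x - cube_mean f a' l'\<bar>" for x
        using lip[of "f x" "cube_mean f a' l'"] by simp
    qed
    also have "\<dots> = l' ^ CARD('n) * \<Psi> (cube_mean f a' l') + K * oscillation f a' l'"
      by (subst set_integral_add(2)) (auto simp: oscillation_def cube_integral_const l'
          set_integrable_abs_diff_const[OF f' l'])
    finally show "cube_integral (\<lambda>x. \<Psi> (f x)) a' l' \<le> \<dots>" .
  qed
  finally show ?thesis
    by (simp add: dyadic_sum_add dyadic_sum_cmult)
qed


definition clamp_real :: "real \<Rightarrow> real \<Rightarrow> real" where
  "clamp_real N y = max (- N) (min N y)"

text \<open>Density of continuous functions in \<open>L\<^sup>1\<close>. A measurable function is almost everywhere a limit of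
continuous functions, but without any domination; clamping \<open>F\<close> and the approximants to \<open>[-N, N]\<close>
supplies it, at the cost of a first application of dominated convergence to the clamping itself.\<close>

lemma integrable_approx_continuous:
  fixes F :: "'a::euclidean_space \<Rightarrow> real"
  assumes F: "integrable lebesgue F" and B: "B \<in> sets lebesgue" "emeasure lebesgue B < \<infinity>" and "\<epsilon> > 0"
  obtains g where "continuous_on UNIV g" "set_integrable lebesgue B g"
    "(LINT x:B|lebesgue. \<bar>F x - g x\<bar>) < \<epsilon>"
proof -
  have [measurable]: "F \<in> borel_measurable lebesgue" "B \<in> sets lebesgue"
    using F B by auto
  have clamp_meas [measurable]: "clamp_real N \<in> borel_measurable borel" for N
    unfolding clamp_real_def[abs_def] by measurable
  have bdd: "\<bar>clamp_real (real N) y\<bar> \<le> real N" for N y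
    by (auto simp: clamp_real_def)
  have "(\<lambda>N. LINT x:B|lebesgue. \<bar>F x - clamp_real (real N) (F x)\<bar>) \<longlonglongrightarrow> (LINT x:B|lebesgue. 0)"
    unfolding set_lebesgue_integral_def real_scaleR_def
  proof (rule integral_dominated_convergence)
    show "integrable lebesgue (\<lambda>x. 2 * \<bar>F x\<bar>)"
      using F by (intro integrable_mult_right integrable_abs) auto
    show "AE x in lebesgue. (\<lambda>N. indicator B x * \<bar>F x - clamp_real (real N) (F x)\<bar>) \<longlonglongrightarrow> indicator B x * 0"
    proof (intro AE_I2 tendsto_mult_left tendsto_eventually)
      fix x
      have "eventually (\<lambda>N. \<bar>F x\<bar> \<le> real N) sequentially"
        using eventually_ge_at_top[of "nat \<lceil>\<bar>F x\<bar>\<rceil>"] by eventually_elim linarith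
      then show "eventually (\<lambda>N. \<bar>F x - clamp_real (real N) (F x)\<bar> = 0) sequentially"
        by eventually_elim (auto simp: clamp_real_def)
    qed
    show "AE x in lebesgue. norm (indicator B x * \<bar>F x - clamp_real (real N) (F x)\<bar>) \<le> 2 * \<bar>F x\<bar>" for N
      by (intro AE_I2) (auto simp: clamp_real_def indicator_def)
  qed measurable
  then have "(\<lambda>N. LINT x:B|lebesgue. \<bar>F x - clamp_real (real N) (F x)\<bar>) \<longlonglongrightarrow> 0"
    by (simp add: set_lebesgue_integral_def)
  then have "eventually (\<lambda>N. (LINT x:B|lebesgue. \<bar>F x - clamp_real (real N) (F x)\<bar>) < \<epsilon> / 2) sequentially"
    using \<open>\<epsilon> > 0\<close> by (intro order_tendstoD) auto
  then obtain N where N: "(LINT x:B|lebesgue. \<bar>F x - clamp_real (real N) (F x)\<bar>) < \<epsilon> / 2"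
    by (auto simp: eventually_sequentially)
  define h where "h = (\<lambda>x. clamp_real (real N) (F x))"
  have [measurable]: "h \<in> borel_measurable lebesgue"
    unfolding h_def by measurable
  have "h measurable_on UNIV"
    by (rule lebesgue_measurable_imp_measurable_on) auto
  then obtain Z u where Z: "negligible Z" and u: "\<And>n. continuous_on UNIV (u n)"
    and lim: "\<And>x. x \<notin> Z \<Longrightarrow> (\<lambda>n. u n x) \<longlonglongrightarrow> h x"
    by (auto simp: measurable_on_def)
  define g where "g = (\<lambda>n x. clamp_real (real N) (u n x))"
  have clamp_cont: "continuous_on UNIV (clamp_real (real N))"
    unfolding clamp_real_def[abs_def] by (intro continuous_intros)
  have g: "continuous_on UNIV (g n)" for n
    unfolding g_def using continuous_on_compose2[OF clamp_cont u[of n]] by auto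
  have g_meas [measurable]: "g n \<in> borel_measurable lebesgue" for n
    by (intro measurable_completion) (simp add: borel_measurable_continuous_onI[OF g])
  have set_int: "set_integrable lebesgue B k" if [measurable]: "k \<in> borel_measurable lebesgue" and "\<And>x. \<bar>k x\<bar> \<le> real N" for k
    unfolding set_integrable_def real_scaleR_def
  proof (rule Bochner_Integration.integrable_bound)
    show "integrable lebesgue (\<lambda>x. indicator B x * real N)"
      using B by (intro integrable_mult_left integrable_real_indicator) auto
    show "AE x in lebesgue. norm (indicator B x * k x) \<le> norm (indicator B x * real N)"
      using that by (auto simp: indicator_def)
  qed measurable
  have "(\<lambda>n. LINT x:B|lebesgue. \<bar>h x - g n x\<bar>) \<longlonglongrightarrow> (LINT x:B|lebesgue. 0)"
    unfolding set_lebesgue_integral_def real_scaleR_def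
  proof (rule integral_dominated_convergence)
    show "integrable lebesgue (\<lambda>x. indicator B x * (2 * real N))"
      using B by (intro integrable_mult_left integrable_real_indicator) auto
    have "AE x in lebesgue. x \<notin> Z"
      using Z by (simp add: AE_not_in negligible_iff_null_sets)
    then show "AE x in lebesgue. (\<lambda>n. indicator B x * \<bar>h x - g n x\<bar>) \<longlonglongrightarrow> indicator B x * 0"
    proof eventually_elim
      case (elim x)
      have "(\<lambda>n. g n x) \<longlonglongrightarrow> clamp_real (real N) (h x)"
        using lim[OF elim] unfolding g_def clamp_real_def by (intro tendsto_intros)
      also have "clamp_real (real N) (h x) = h x"
        by (auto simp: h_def clamp_real_def)
      finally have "(\<lambda>n. \<bar>h x - g n x\<bar>) \<longlonglongrightarrow> \<bar>h x - h x\<bar>"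
        by (intro tendsto_intros)
      then show ?case
        by (intro tendsto_mult_left) simp
    qed
    have "\<bar>h x - g n x\<bar> \<le> 2 * real N" for n x
      using bdd[of N "F x"] bdd[of N "u n x"] unfolding h_def g_def by linarith
    then show "AE x in lebesgue. norm (indicator B x * \<bar>h x - g n x\<bar>) \<le> indicator B x * (2 * real N)" for n
      by (auto simp: indicator_def)
  qed measurable
  then have "(\<lambda>n. LINT x:B|lebesgue. \<bar>h x - g n x\<bar>) \<longlonglongrightarrow> 0"
    by (simp add: set_lebesgue_integral_def)
  then have "eventually (\<lambda>n. (LINT x:B|lebesgue. \<bar>h x - g n x\<bar>) < \<epsilon> / 2) sequentially"
    using \<open>\<epsilon> > 0\<close> by (intro order_tendstoD) auto
  then obtain n where n: "(LINT x:B|lebesgue. \<bar>h x - g n x\<bar>) < \<epsilon> / 2"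
    by (auto simp: eventually_sequentially)
  have Fi: "set_integrable lebesgue B F"
    using integrable_mult_indicator[OF B(1) F] by (simp add: set_integrable_def)
  have hi: "set_integrable lebesgue B h"
    by (rule set_int) (auto simp: h_def bdd)
  have gi: "set_integrable lebesgue B (g n)"
    by (rule set_int[OF g_meas]) (auto simp: g_def bdd)
  have "(LINT x:B|lebesgue. \<bar>F x - g n x\<bar>) \<le> (LINT x:B|lebesgue. \<bar>F x - h x\<bar> + \<bar>h x - g n x\<bar>)"
    by (intro set_integral_mono set_integral_add(1) set_integrable_abs set_integral_diff(1) Fi hi gi) auto
  also have "\<dots> = (LINT x:B|lebesgue. \<bar>F x - h x\<bar>) + (LINT x:B|lebesgue. \<bar>h x - g n x\<bar>)"
    by (intro set_integral_add(2) set_integrable_abs set_integral_diff(1) Fi hi gi)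
  also have "\<dots> < \<epsilon>"
    using N n by (simp add: h_def)
  finally show ?thesis
    using that g gi by blast
qed

lemma half_open_cube_corner: "l > 0 \<Longrightarrow> a \<in> half_open_cube a l"
  by (simp add: half_open_cube_def)

lemma dist_half_open_cube_corner:
  fixes a x :: "real ^ 'n"
  assumes "x \<in> half_open_cube a l"
  shows "dist x a \<le> real CARD('n) * l"
proof -
  have "dist x a \<le> (\<Sum>i\<in>UNIV. \<bar>(x - a) $ i\<bar>)"
    unfolding dist_norm by (rule norm_le_l1_cart)
  also have "\<dots> \<le> (\<Sum>i\<in>(UNIV :: 'n set). l)"
  proof (rule sum_mono)
    fix i
    show "\<bar>(x - a) $ i\<bar> \<le> l"
      using assms[unfolded half_open_cube_def, simplified, rule_format, of i] by simp
  qed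
  finally show ?thesis by simp
qed

text \<open>For a continuous \<open>g\<close> near \<open>f\<close> in \<open>L\<^sup>1\<close>, the oscillation of \<open>f\<close> on a small cube is compared with its
distance to the value of \<open>g\<close> at the corner: the error splits into the additive quantity
\<open>\<integral>\<bar>f - g\<bar>\<close> and the modulus of continuity of \<open>g\<close>.\<close>

lemma dyadic_sum_oscillation_small:
  fixes f :: "real ^ 'n \<Rightarrow> real"
  assumes f: "set_integrable lebesgue (half_open_cube a l) f" and l: "l > 0" and "\<epsilon> > 0"
  shows "\<exists>k. dyadic_sum k (oscillation f) a l \<le> \<epsilon>"
proof -
  define F where "F = (\<lambda>x. indicator (half_open_cube a l) x * f x)"
  have F: "integrable lebesgue F"
    using f by (simp add: F_def set_integrable_def)
  obtain g where g: "continuous_on UNIV g" "set_integrable lebesgue (half_open_cube a l) g"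
    and gF: "cube_integral (\<lambda>x. \<bar>F x - g x\<bar>) a l < \<epsilon> / 4"
    using integrable_approx_continuous[OF F half_open_cube_lebesgue, of a l "\<epsilon> / 4"] \<open>\<epsilon> > 0\<close> l
    by (auto simp: emeasure_half_open_cube)
  have "cube_integral (\<lambda>x. \<bar>F x - g x\<bar>) a l = cube_integral (\<lambda>x. \<bar>f x - g x\<bar>) a l"
    unfolding set_lebesgue_integral_def by (intro Bochner_Integration.integral_cong) (auto simp: F_def indicator_def)
  with gF have gf: "cube_integral (\<lambda>x. \<bar>f x - g x\<bar>) a l < \<epsilon> / 4"
    by simp
  define \<eta> where "\<eta> = \<epsilon> / (4 * l ^ CARD('n))"
  have "\<eta> > 0"
    using \<open>\<epsilon> > 0\<close> l by (simp add: \<eta>_def)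
  have "uniformly_continuous_on (cbox a (a + (\<chi> i. l))) g"
    using g(1) by (intro compact_uniformly_continuous) (auto intro: continuous_on_subset)
  then obtain \<delta> where "\<delta> > 0" and \<delta>: "\<And>x y. x \<in> cbox a (a + (\<chi> i. l)) \<Longrightarrow> y \<in> cbox a (a + (\<chi> i. l)) \<Longrightarrow>
      dist x y < \<delta> \<Longrightarrow> dist (g x) (g y) < \<eta>"
    using \<open>\<eta> > 0\<close> unfolding uniformly_continuous_on_def by metis
  have "(\<lambda>k. real CARD('n) * (l / 2 ^ k)) \<longlonglongrightarrow> real CARD('n) * 0"
    by (intro tendsto_mult_left LIMSEQ_divide_realpow_zero) auto
  then have "eventually (\<lambda>k. real CARD('n) * (l / 2 ^ k) < \<delta>) sequentially"
    using \<open>\<delta> > 0\<close> by (intro order_tendstoD) auto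
  then obtain k where k: "real CARD('n) * (l / 2 ^ k) < \<delta>"
    by (auto simp: eventually_sequentially)
  define G where "G = (\<lambda>x. 2 * \<bar>f x - g x\<bar> + 2 * \<eta>)"
  have Gi: "set_integrable lebesgue (half_open_cube a l) G"
    unfolding G_def by (intro set_integral_add(1) set_integrable_mult_right set_integrable_abs set_integral_diff(1) f g
      set_integrable_const_cube l)
  have "dyadic_sum k (oscillation f) a l \<le> dyadic_sum k (cube_integral G) a l"
  proof (rule dyadic_sum_mono[OF _ l])
    fix a' and l' :: real
    assume l': "l' > 0" "l' = l / 2 ^ k" and sub: "half_open_cube a' l' \<subseteq> half_open_cube a l"
    have f': "set_integrable lebesgue (half_open_cube a' l') f"
      using sub by (intro set_integrable_subset[OF f]) auto
    have G': "set_integrable lebesgue (half_open_cube a' l') G"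
      using sub by (intro set_integrable_subset[OF Gi]) auto
    have "oscillation f a' l' \<le> 2 * cube_integral (\<lambda>x. \<bar>f x - g a'\<bar>) a' l'"
      by (rule oscillation_le[OF f' l'(1)])
    also have "\<dots> = cube_integral (\<lambda>x. 2 * \<bar>f x - g a'\<bar>) a' l'"
      by simp
    also have "\<dots> \<le> cube_integral G a' l'"
    proof (rule set_integral_mono[OF set_integrable_mult_right[OF set_integrable_abs_diff_const[OF f' l'(1)]] G'])
      fix x assume x: "x \<in> half_open_cube a' l'"
      have "dist x a' < \<delta>"
        using dist_half_open_cube_corner[OF x] k l' by simp
      then have "dist (g x) (g a') < \<eta>"
        using x sub half_open_cube_corner[OF l'(1), of a'] box_subset_half_open_cube_subset_cbox(2)[of a l]
        by (intro \<delta>) auto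
      moreover have "\<bar>f x - g a'\<bar> \<le> \<bar>f x - g x\<bar> + dist (g x) (g a')"
        unfolding dist_real_def by linarith
      ultimately show "2 * \<bar>f x - g a'\<bar> \<le> G x"
        unfolding G_def by argo
    qed
    finally show "oscillation f a' l' \<le> cube_integral G a' l'" .
  qed
  also have "\<dots> = cube_integral G a l"
    by (rule dyadic_sum_integral[OF Gi l])
  also have "\<dots> = 2 * cube_integral (\<lambda>x. \<bar>f x - g x\<bar>) a l + 2 * \<eta> * l ^ CARD('n)"
    unfolding G_def using l
    by (subst set_integral_add(2)) (auto simp: cube_integral_const intro!: set_integrable_abs set_integral_diff(1) f g)
  also have "\<dots> \<le> \<epsilon>"
    using gf l by (simp add: \<eta>_def)
  finally show ?thesis by blast
qed


section \<open>The John--Nirenberg inequality\<close>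

text \<open>Truncating inside the exponential, rather than outside, leaves a composition of a
Lipschitz function bounded above by \<open>L\<close> with the exponential, whose slope there is at most \<open>exp L\<close>.\<close>

lemma exp_min_lipschitz:
  fixes b L s t :: real
  assumes "b \<ge> 0"
  shows "\<bar>exp (min (b * \<bar>s - c\<bar>) L) - exp (min (b * \<bar>t - c\<bar>) L)\<bar> \<le> exp L * b * \<bar>s - t\<bar>"
proof -
  have exp_le: "\<bar>exp u - exp v\<bar> \<le> exp L * \<bar>u - v\<bar>" if "u \<le> L" "v \<le> L" for u v :: real
    using that
  proof (induction u v rule: linorder_wlog)
    case (le u v)
    have "exp v - exp u = exp v * (1 - exp (u - v))"
      by (simp add: right_diff_distrib flip: exp_add)
    also have "\<dots> \<le> exp L * (v - u)"
    proof (rule mult_mono)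
      show "1 - exp (u - v) \<le> v - u"
        using exp_ge_add_one_self[of "u - v"] by linarith
    qed (use le in auto)
    finally show ?case
      using le by (simp add: abs_if)
  qed (simp add: abs_minus_commute)
  have "\<bar>min (b * \<bar>s - c\<bar>) L - min (b * \<bar>t - c\<bar>) L\<bar> \<le> \<bar>b * \<bar>s - c\<bar> - b * \<bar>t - c\<bar>\<bar>"
    by (auto simp: min_def)
  also have "\<dots> = b * \<bar>\<bar>s - c\<bar> - \<bar>t - c\<bar>\<bar>"
    using assms by (simp add: abs_mult flip: right_diff_distrib)
  also have "\<dots> \<le> b * \<bar>s - t\<bar>"
    using assms by (intro mult_left_mono) auto
  finally have "exp L * \<bar>min (b * \<bar>s - c\<bar>) L - min (b * \<bar>t - c\<bar>) L\<bar> \<le> exp L * (b * \<bar>s - t\<bar>)"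
    by (intro mult_left_mono) auto
  then show ?thesis
    unfolding mult.assoc by (rule order_trans[rotated]) (simp add: exp_le)
qed

lemma truncated_exp_integral_le:
  fixes f :: "real ^ 'n \<Rightarrow> real"
  assumes int: "\<And>a l. l > 0 \<Longrightarrow> set_integrable lebesgue (half_open_cube a l) f"
    and osc: "\<And>a l. l > 0 \<Longrightarrow> oscillation f a l \<le> l ^ CARD('n)"
    and b: "0 \<le> b" "exp (b * 2 ^ (CARD('n) + 1)) \<le> 3 / 2"
    and l: "l > 0"
  shows "cube_integral (\<lambda>x. exp (min (b * \<bar>f x - cube_mean f a l\<bar>) L)) a l \<le> 3 * l ^ CARD('n)"
proof (rule field_le_epsilon)
  fix e :: real assume "e > 0"
  define c where "c = cube_mean f a l"
  define K where "K = exp L * b"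
  have "K \<ge> 0" using b by (simp add: K_def)
  have osc': "cube_integral (\<lambda>x. \<bar>f x - c\<bar>) a l \<le> l ^ CARD('n)"
    using osc[OF l, of a] by (simp add: oscillation_def c_def)
  have two: "(1 :: real) \<le> 2 ^ (CARD('n) + 1)"
    by (rule one_le_power) simp
  obtain k where k: "dyadic_sum k (oscillation f) a l \<le> e / (K + 1)"
    using dyadic_sum_oscillation_small[OF int[OF l] l, of "e / (K + 1)"] \<open>e > 0\<close> \<open>K \<ge> 0\<close> by auto
  have "cube_integral (\<lambda>x. exp (min (b * \<bar>f x - c\<bar>) L)) a l
    \<le> dyadic_sum k (\<lambda>a l. l ^ CARD('n) * exp (min (b * \<bar>cube_mean f a l - c\<bar>) L)) a l
       + K * dyadic_sum k (oscillation f) a l"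
    by (rule cube_integral_lipschitz_le[OF int[OF l] l]) (simp add: K_def exp_min_lipschitz[OF b(1)])
  also have "dyadic_sum k (\<lambda>a l. l ^ CARD('n) * exp (min (b * \<bar>cube_mean f a l - c\<bar>) L)) a l
     \<le> dyadic_sum k (\<lambda>a l. l ^ CARD('n) * exp (b * \<bar>cube_mean f a l - c\<bar>)) a l"
    by (rule dyadic_sum_mono[OF _ l]) (auto intro!: mult_left_mono)
  also have "\<dots> \<le> 3 / 2 * (l ^ CARD('n) + cube_integral (\<lambda>x. \<bar>f x - c\<bar>) a l)"
  proof (rule dyadic_sum_exp_le[OF int osc b l])
    have "1 * l ^ CARD('n) \<le> 2 ^ (CARD('n) + 1) * l ^ CARD('n)"
      using l by (intro mult_right_mono two) auto
    then show "cube_integral (\<lambda>x. \<bar>f x - c\<bar>) a l \<le> 2 ^ (CARD('n) + 1) * l ^ CARD('n)"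
      using osc' by linarith
  qed
  also have "\<dots> \<le> 3 * l ^ CARD('n)"
    using osc' by simp
  also have "K * dyadic_sum k (oscillation f) a l \<le> K * (e / (K + 1))"
    using k \<open>K \<ge> 0\<close> by (rule mult_left_mono)
  also have "\<dots> \<le> e"
    using \<open>e > 0\<close> \<open>K \<ge> 0\<close> by (simp add: field_simps)
  finally show "cube_integral (\<lambda>x. exp (min (b * \<bar>f x - cube_mean f a l\<bar>) L)) a l \<le> 3 * l ^ CARD('n) + e"
    by (simp add: c_def)
qed

text \<open>Monotone convergence as the truncation level tends to infinity.\<close>

lemma john_nirenberg_exponential_normalized:
  fixes f :: "real ^ 'n \<Rightarrow> real"
  assumes int: "\<And>a l. l > 0 \<Longrightarrow> set_integrable lebesgue (half_open_cube a l) f"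
    and osc: "\<And>a l. l > 0 \<Longrightarrow> oscillation f a l \<le> l ^ CARD('n)"
    and b: "0 \<le> b" "exp (b * 2 ^ (CARD('n) + 1)) \<le> 3 / 2"
    and l: "l > 0"
  shows "(\<integral>\<^sup>+x\<in>half_open_cube a l. ennreal (exp (b * \<bar>f x - cube_mean f a l\<bar>)) \<partial>lebesgue) \<le> ennreal (3 * l ^ CARD('n))"
proof -
  let ?Q = "half_open_cube a l"
  define u where "u = (\<lambda>x. b * \<bar>f x - cube_mean f a l\<bar>)"
  have int_min: "integrable lebesgue (\<lambda>x. indicator ?Q x * exp (min (u x) L))" for L
    using set_integrable_lipschitz[OF int[OF l] l exp_min_lipschitz[OF b(1)], of a "cube_mean f a l" L]
    by (simp add: set_integrable_def u_def)
  have meas: "(\<lambda>x. ennreal (indicator ?Q x * exp (min (u x) L))) \<in> borel_measurable lebesgue" for L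
    using borel_measurable_integrable[OF int_min[of L]] by measurable
  have SUP: "(SUP j::nat. ennreal (indicator ?Q x * exp (min (u x) (real j)))) = ennreal (exp (u x)) * indicator ?Q x" for x
  proof (rule antisym)
    show "(SUP j::nat. ennreal (indicator ?Q x * exp (min (u x) (real j)))) \<le> ennreal (exp (u x)) * indicator ?Q x"
      by (rule SUP_least) (auto simp: indicator_def intro!: ennreal_leI)
    have "u x \<le> real (nat \<lceil>u x\<rceil>)"
      by linarith
    then show "ennreal (exp (u x)) * indicator ?Q x \<le> (SUP j::nat. ennreal (indicator ?Q x * exp (min (u x) (real j))))"
      by (intro SUP_upper2[of "nat \<lceil>u x\<rceil>"]) (auto simp: indicator_def min_absorb1)
  qed
  have "(\<integral>\<^sup>+x\<in>?Q. ennreal (exp (u x)) \<partial>lebesgue)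
     = (\<integral>\<^sup>+x. (SUP j::nat. ennreal (indicator ?Q x * exp (min (u x) (real j)))) \<partial>lebesgue)"
    by (simp only: SUP)
  also have "\<dots> = (SUP j::nat. \<integral>\<^sup>+x. ennreal (indicator ?Q x * exp (min (u x) (real j))) \<partial>lebesgue)"
  proof (rule nn_integral_monotone_convergence_SUP[OF _ meas])
    show "incseq (\<lambda>j x. ennreal (indicator ?Q x * exp (min (u x) (real j))))"
      by (auto simp: incseq_def le_fun_def intro!: ennreal_leI mult_left_mono)
  qed
  also have "\<dots> \<le> ennreal (3 * l ^ CARD('n))"
  proof (rule SUP_least)
    fix j :: nat
    have "(\<integral>\<^sup>+x. ennreal (indicator ?Q x * exp (min (u x) (real j))) \<partial>lebesgue)
       = ennreal (LINT x|lebesgue. indicator ?Q x * exp (min (u x) (real j)))"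
      by (rule nn_integral_eq_integral[OF int_min]) auto
    also have "\<dots> \<le> ennreal (3 * l ^ CARD('n))"
      using truncated_exp_integral_le[OF int osc b l, of a "real j"]
      by (intro ennreal_leI) (simp add: set_lebesgue_integral_def u_def)
    finally show "(\<integral>\<^sup>+x. ennreal (indicator ?Q x * exp (min (u x) (real j))) \<partial>lebesgue) \<le> ennreal (3 * l ^ CARD('n))" .
  qed
  finally show ?thesis
    by (simp add: u_def)
qed

text \<open>Reduction to the normalized case by homogeneity, through \<open>f / M\<close>.\<close>

lemma john_nirenberg_exponential:
  fixes f :: "real ^ 'n \<Rightarrow> real"
  assumes int: "\<And>a l. l > 0 \<Longrightarrow> set_integrable lebesgue (half_open_cube a l) f"
    and M: "M > 0" and osc: "\<And>a l. l > 0 \<Longrightarrow> oscillation f a l \<le> M * l ^ CARD('n)"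
    and b: "0 \<le> b" "exp (b * 2 ^ (CARD('n) + 1)) \<le> 3 / 2"
    and l: "l > 0"
  shows "(\<integral>\<^sup>+x\<in>half_open_cube a l. ennreal (exp (b / M * \<bar>f x - cube_mean f a l\<bar>)) \<partial>lebesgue) \<le> ennreal (3 * l ^ CARD('n))"
proof -
  have mean: "cube_mean (\<lambda>x. f x / M) a l = cube_mean f a l / M" for a :: "real ^ 'n" and l
    by (simp add: cube_mean_def)
  have abs: "\<bar>f x / M - cube_mean f a l / M\<bar> = \<bar>f x - cube_mean f a l\<bar> / M" for x a :: "real ^ 'n" and l
    using M abs_divide[of "f x - cube_mean f a l" M] by (simp add: diff_divide_distrib)
  have "oscillation (\<lambda>x. f x / M) a l \<le> l ^ CARD('n)" if "l > 0" for a :: "real ^ 'n" and l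
  proof -
    have "oscillation (\<lambda>x. f x / M) a l = oscillation f a l / M"
      by (simp add: oscillation_def mean abs)
    then show ?thesis
      using osc[OF that, of a] M by (simp add: pos_divide_le_eq mult.commute)
  qed
  then have "(\<integral>\<^sup>+x\<in>half_open_cube a l. ennreal (exp (b * \<bar>f x / M - cube_mean (\<lambda>x. f x / M) a l\<bar>)) \<partial>lebesgue) \<le> ennreal (3 * l ^ CARD('n))"
    using int by (intro john_nirenberg_exponential_normalized b l) auto
  then show ?thesis
    by (simp add: mean abs)
qed

section \<open>The variable-exponent norm\<close>

text \<open>The single place where the size of the exponent enters. It gives a bound by \<open>exp t\<close> that no longer
depends on \<open>p\<close>; the factor \<open>3\<close> cancels the constant in the John--Nirenberg inequality, and it
survives the power because \<open>1 \<le> p\<close>.\<close>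

lemma exponent_power_le_exp:
  assumes p: "1 \<le> p" "p \<le> ennreal q" and t: "t \<ge> 0"
  shows "exponent_power (t / (3 * q)) p \<le> ennreal (exp t / 3)"
proof -
  obtain r where r: "p = ennreal r" "r \<ge> 0"
    using p(2) by (cases p) (auto simp: top_unique)
  have r1: "1 \<le> r" "r \<le> q"
    using p r by (auto simp: ennreal_le_iff2 simp flip: ennreal_1)
  have "(t / q / 3) powr r = (t / q) powr r * (1 / 3) powr r"
    using t r1 powr_mult[of "t / q" "1 / 3" r] by simp
  also have "\<dots> \<le> exp t * (1 / 3)"
  proof (rule mult_mono)
    have "t / q \<le> exp (t / q)"
      using exp_ge_add_one_self[of "t / q"] by linarith
    then have "(t / q) powr r \<le> exp (t / q) powr r"
      using t r1 by (intro powr_mono2) auto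
    also have "\<dots> = exp (t * (r / q))"
      by (simp add: powr_def)
    also have "\<dots> \<le> exp t"
      using t r1 mult_left_mono[of "r / q" 1 t] by simp
    finally show "(t / q) powr r \<le> exp t" .
    show "(1 / 3 :: real) powr r \<le> 1 / 3"
      using powr_mono'[of 1 r "1 / 3 :: real"] r1 by simp
  qed auto
  finally show ?thesis
    using r by (auto simp: exponent_power_def intro!: ennreal_leI) (simp add: mult.commute)
qed

lemma set_integrable_half_open_cube:
  fixes f :: "real ^ 'n \<Rightarrow> real"
  assumes "f \<in> L1_loc"
  shows "set_integrable lebesgue (half_open_cube a l) f"
proof -
  have f: "set_integrable lebesgue (cbox a (a + (\<chi> i. l))) f"
    using assms by (auto simp: L1_loc_def)
  show ?thesis
    by (rule set_integrable_subset[OF f _ box_subset_half_open_cube_subset_cbox(2)]) auto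
qed

lemma avg_cbox_eq_cube_mean:
  fixes f :: "real ^ 'n \<Rightarrow> real"
  assumes "f \<in> L1_loc" "l > 0"
  shows "avg f (cbox a (a + (\<chi> i. l))) = cube_mean f a l"
proof -
  have f: "set_integrable lebesgue (cbox a (a + (\<chi> i. l))) f"
    using assms by (auto simp: L1_loc_def)
  have f': "set_integrable lebesgue (half_open_cube a l) f"
    by (rule set_integrable_half_open_cube[OF assms(1)])
  have "(LINT x:cbox a (a + (\<chi> i. l))|lebesgue. f x) = cube_integral f a l"
    using f f' AE_half_open_cube_iff_cbox[of a l]
    by (intro set_integral_cong_set) (auto simp: set_borel_measurable_def set_integrable_def borel_measurable_integrable)
  moreover have "measure lebesgue (cbox a (a + (\<chi> i. l))) = measure lebesgue (half_open_cube a l)"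
    by (rule measure_eq_AE) (use AE_half_open_cube_iff_cbox[of a l] in auto)
  ultimately show "avg f (cbox a (a + (\<chi> i. l))) = cube_mean f a l"
    using assms by (simp only: avg_def cube_mean_def measure_half_open_cube)
qed

lemma nn_avg_cbox:
  fixes g :: "real ^ 'n \<Rightarrow> ennreal"
  assumes "l > 0"
  shows "nn_avg g (cbox a (a + (\<chi> i. l))) = (\<integral>\<^sup>+x\<in>half_open_cube a l. g x \<partial>lebesgue) / ennreal (l ^ CARD('n))"
proof -
  have "(\<integral>\<^sup>+x\<in>cbox a (a + (\<chi> i. l)). g x \<partial>lebesgue) = (\<integral>\<^sup>+x\<in>half_open_cube a l. g x \<partial>lebesgue)"
    by (rule nn_integral_cong_AE) (use AE_half_open_cube_iff_cbox[of a l] in \<open>eventually_elim, auto simp: indicator_def\<close>)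
  moreover have "emeasure lebesgue (cbox a (a + (\<chi> i. l))) = emeasure lebesgue (half_open_cube a l)"
    by (rule emeasure_eq_AE) (use AE_half_open_cube_iff_cbox[of a l] in auto)
  ultimately show ?thesis
    using assms by (simp only: nn_avg_def emeasure_half_open_cube)
qed

lemma oscillation_le_bmo_norm:
  fixes f :: "real ^ 'n \<Rightarrow> real"
  assumes f: "f \<in> L1_loc" and M: "bmo_norm f \<le> ennreal M" "M \<ge> 0" and l: "l > 0"
  shows "oscillation f a l \<le> M * l ^ CARD('n)"
proof -
  let ?Q = "cbox a (a + (\<chi> i. l))"
  have "nn_avg (\<lambda>x. ennreal \<bar>f x - avg f ?Q\<bar>) ?Q \<le> ennreal M"
    using l by (intro order_trans[OF SUP_upper M(1)[unfolded bmo_norm_def]]) (auto simp: cubes_def)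
  then have "(\<integral>\<^sup>+x\<in>half_open_cube a l. ennreal \<bar>f x - cube_mean f a l\<bar> \<partial>lebesgue) / ennreal (l ^ CARD('n)) \<le> ennreal M"
    by (simp only: nn_avg_cbox[OF l] avg_cbox_eq_cube_mean[OF f l])
  also have "(\<integral>\<^sup>+x\<in>half_open_cube a l. ennreal \<bar>f x - cube_mean f a l\<bar> \<partial>lebesgue)
     = (\<integral>\<^sup>+x. ennreal (indicator (half_open_cube a l) x * \<bar>f x - cube_mean f a l\<bar>) \<partial>lebesgue)"
    by (intro nn_integral_cong) (auto simp: indicator_def)
  also have "\<dots> = ennreal (oscillation f a l)"
    using set_integrable_abs_diff_const[OF set_integrable_half_open_cube[OF f, of a l] l, of "cube_mean f a l"]
    unfolding oscillation_def set_lebesgue_integral_def set_integrable_def real_scaleR_def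
    by (intro nn_integral_eq_integral) auto
  finally have "ennreal (oscillation f a l / l ^ CARD('n)) \<le> ennreal M"
    using l by (subst (asm) divide_ennreal) (auto simp: oscillation_def intro!: cube_integral_nonneg)
  then show ?thesis
    using l M by (simp add: ennreal_le_iff field_simps)
qed

text \<open>Here \<open>M\<close> is any positive upper bound of the BMO norm, not the norm itself, which may vanish.\<close>

lemma local_Lp_norm_le:
  fixes p :: "real ^ 'n \<Rightarrow> ennreal"
  assumes p: "exponent_function p" "exponent_sup p = ennreal q" and q: "q > 0"
    and f: "f \<in> L1_loc" and M: "bmo_norm f \<le> ennreal M" "M > 0" and Q: "Q \<in> cubes"
    and b: "0 < b" "exp (b * 2 ^ (CARD('n) + 1)) \<le> 3 / 2"
  shows "local_Lp_norm p Q (\<lambda>x. f x - avg f Q) \<le> ennreal (3 / b * q * M)"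
proof -
  obtain a l where Qdef: "Q = cbox a (a + (\<chi> i. l))" and l: "l > 0"
    using Q by (auto simp: cubes_def)
  define m where "m = cube_mean f a l"
  have m: "avg f Q = m"
    unfolding Qdef m_def by (rule avg_cbox_eq_cube_mean[OF f l])
  define c where "c = 3 / b * q * M"
  have c: "c > 0"
    using b q M by (simp add: c_def)
  define h where "h = (\<lambda>x. ennreal (exp (b / M * \<bar>f x - m\<bar>)))"
  have "(\<integral>\<^sup>+x\<in>half_open_cube a l. exponent_power (\<bar>f x - m\<bar> / c) (p x) \<partial>lebesgue)
     \<le> (\<integral>\<^sup>+x. h x * indicator (half_open_cube a l) x / 3 \<partial>lebesgue)"
  proof (rule nn_integral_mono_AE)
    have "AE x in lebesgue. p x \<le> ennreal q"
      using esssup_AE[where M = lebesgue and f = p] p(2) by (simp add: exponent_sup_def)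
    then show "AE x in lebesgue. exponent_power (\<bar>f x - m\<bar> / c) (p x) * indicator (half_open_cube a l) x
       \<le> h x * indicator (half_open_cube a l) x / 3"
    proof eventually_elim
      case (elim x)
      have "\<bar>f x - m\<bar> / c = b / M * \<bar>f x - m\<bar> / (3 * q)"
        using b q M by (simp add: c_def field_simps)
      also have "exponent_power (b / M * \<bar>f x - m\<bar> / (3 * q)) (p x) \<le> ennreal (exp (b / M * \<bar>f x - m\<bar>) / 3)"
        using p(1) elim b M by (intro exponent_power_le_exp) (auto simp: exponent_function_def)
      also have "\<dots> = h x / 3"
        by (simp add: h_def divide_ennreal flip: ennreal_numeral)
      finally show ?case
        by (simp add: indicator_def)
    qed
  qed
  also have "\<dots> = (\<integral>\<^sup>+x\<in>half_open_cube a l. h x \<partial>lebesgue) / 3"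
  proof (rule nn_integral_divide)
    define F where "F = (\<lambda>x. indicator (half_open_cube a l) x * f x)"
    have [measurable]: "F \<in> borel_measurable lebesgue"
      using set_integrable_half_open_cube[OF f] unfolding F_def set_integrable_def real_scaleR_def
      by (rule borel_measurable_integrable)
    have "(\<lambda>x. h x * indicator (half_open_cube a l) x)
        = (\<lambda>x. ennreal (exp (b / M * \<bar>F x - m\<bar>)) * indicator (half_open_cube a l) x)"
      by (auto simp: h_def F_def indicator_def)
    also have "\<dots> \<in> borel_measurable lebesgue"
      by measurable
    finally show "(\<lambda>x. h x * indicator (half_open_cube a l) x) \<in> borel_measurable lebesgue" .
  qed
  also have "\<dots> \<le> ennreal (3 * l ^ CARD('n)) / 3"
    unfolding h_def m_def using b
    by (intro divide_right_mono_ennreal john_nirenberg_exponential[OF set_integrable_half_open_cube[OF f] M(2) oscillation_le_bmo_norm[OF f M(1)]] l) (use M in auto)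
  also have "\<dots> = ennreal (l ^ CARD('n))"
    using l by (simp add: divide_ennreal flip: ennreal_numeral)
  finally have "nn_avg (\<lambda>x. exponent_power (\<bar>f x - m\<bar> / c) (p x)) Q \<le> ennreal (l ^ CARD('n)) / ennreal (l ^ CARD('n))"
    unfolding Qdef nn_avg_cbox[OF l] by (rule divide_right_mono_ennreal)
  also have "\<dots> = 1"
    using l by (simp add: divide_ennreal)
  finally show ?thesis
    unfolding local_Lp_norm_def m using c by (intro INF_lower2[of c]) (auto simp: c_def)
qed

theorem corollary1p2:
  shows "\<exists>C::real. C > 0 \<and>
    (\<forall>p :: real ^ 'n \<Rightarrow> ennreal. exponent_function p \<and> essentially_bounded p \<longrightarrow>
      (\<forall>Q \<in> cubes. \<forall>f \<in> BMO.
        local_Lp_norm p Q (\<lambda>x. f x - avg f Q) \<le> ennreal C * exponent_sup p * bmo_norm f))"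
proof -
  \<comment> \<open>The largest \<open>b\<close> with \<open>exp (b * 2 ^ (n + 1)) \<le> 3 / 2\<close>.\<close>
  define b :: real where "b = ln (3 / 2) / 2 ^ (CARD('n) + 1)"
  have b: "b > 0" "exp (b * 2 ^ (CARD('n) + 1)) \<le> 3 / 2"
    by (simp_all add: b_def)
  show ?thesis
  proof (intro exI[of _ "3 / b"] conjI allI impI ballI)
    show "3 / b > 0"
      using b by simp
    fix p :: "real ^ 'n \<Rightarrow> ennreal" and Q :: "(real ^ 'n) set" and f :: "real ^ 'n \<Rightarrow> real"
    assume p: "exponent_function p \<and> essentially_bounded p" and Q: "Q \<in> cubes" and f: "f \<in> BMO"
    obtain q where q: "exponent_sup p = ennreal q" "q \<ge> 0"
      using p by (cases "exponent_sup p") (auto simp: essentially_bounded_def)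
    \<comment> \<open>Lebesgue measure is nonzero, so the lower bound \<open>1\<close> of \<open>p\<close> carries over to its essential supremum.\<close>
    have "esssup lebesgue (\<lambda>x :: real ^ 'n. 1 :: ennreal) \<le> esssup lebesgue p"
      using p by (intro esssup_mono) (auto simp: exponent_function_def)
    then have "1 \<le> exponent_sup p"
      by (simp add: esssup_const exponent_sup_def)
    then have "q > 0"
      using q by (cases "q = 0") auto
    obtain m where m: "bmo_norm f = ennreal m" "m \<ge> 0"
      using f by (cases "bmo_norm f") (auto simp: BMO_def)
    have f': "f \<in> L1_loc"
      using f by (simp add: BMO_def)
    show "local_Lp_norm p Q (\<lambda>x. f x - avg f Q) \<le> ennreal (3 / b) * exponent_sup p * bmo_norm f"
    proof (rule ennreal_le_epsilon)
      fix e :: real assume "e > 0"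
      \<comment> \<open>Enlarging the norm \<open>m\<close> by \<open>d\<close> makes the bound positive and changes the right-hand side by \<open>e\<close>.\<close>
      define d where "d = e / (3 / b * q)"
      have "d > 0"
        using \<open>e > 0\<close> b \<open>q > 0\<close> by (simp add: d_def)
      then have "local_Lp_norm p Q (\<lambda>x. f x - avg f Q) \<le> ennreal (3 / b * q * (m + d))"
        using p q m f' Q b \<open>q > 0\<close> by (intro local_Lp_norm_le) (auto intro: ennreal_leI)
      also have "3 / b * q * (m + d) = 3 / b * q * m + e"
        using b \<open>q > 0\<close> by (simp add: d_def field_simps)
      also have "ennreal \<dots> = ennreal (3 / b) * exponent_sup p * bmo_norm f + ennreal e"
        unfolding m q using b \<open>q > 0\<close> m(2) \<open>e > 0\<close> by (simp add: ennreal_plus flip: ennreal_mult)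
      finally show "local_Lp_norm p Q (\<lambda>x. f x - avg f Q) \<le> ennreal (3 / b) * exponent_sup p * bmo_norm f + ennreal e" .
    qed
  qed
qed

end
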